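(* Let $\mathcal{G}=(\mathcal{V},\mathcal{E})$ be a finite undirected graph without loops, with $\mathcal{V}=\mathcal{B}\cup\mathcal{I}$ partitioned into boundary nodes $\mathcal{B}$ and interior nodes $\mathcal{I}$. Let $\sigma:\mathcal{E}\to(0,\infty)$ be such that $(L_\sigma)_{\mathcal{I}\mathcal{I}}$ is invertible, let $f:\mathcal{B}\to\mathbb{R}$, and let $u:\mathcal{V}\to\mathbb{R}$ solve the Dirichlet problem $[\nabla^T(\sigma\odot\nabla u)]_{\mathcal{I}}=0$, $u_{\mathcal{B}}=f$. Let $T_0>0$ be a constant background temperature and $\delta T\in\mathbb{R}$ with $T_0+\delta T>0$. Let $\langle g_0g_0^T\rangle$ be the covariance of the thermal-noise boundary currents when all edges have temperature $T_0$, and for $e\in\mathcal{E}$ let $\langle g_eg_e^T\rangle$ be the covariance of the thermal-noise boundary currents when the temperature is $T_e=T_0+\delta T\,\delta_e$. Then $$\big[f^T(\langle g_eg_e^T\rangle-\langle g_0g_0^T\rangle)f\big]_{e\in\mathcal{E}}=\frac{\kappa}{\pi}\,\delta T\;\sigma\odot|\nabla R_{\mathcal{I}}^TR_{\mathcal{I}}u|^2,$$ as an equality of vectors in $\mathbb{R}^{\mathcal{E}}$.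
   Context: For each edge $i\sim j$ an ordering of its endpoints is fixed once and for all. The discrete gradient $\nabla:\mathbb{R}^{\mathcal{V}}\to\mathbb{R}^{\mathcal{E}}$ is $(\nabla u)(i\sim j)=u(i)-u(j)$, and $\nabla^T$ is its transpose. $\odot$ is the componentwise product; absolute values and squares of vectors are componentwise. $L_\sigma u=\nabla^T(\sigma\odot\nabla u)$ is the discrete Laplacian, viewed as a symmetric $|\mathcal{V}|\times|\mathcal{V}|$ matrix; double subscripts denote submatrices (rows, columns), and subscripting a vector by a set of nodes denotes restriction to it. $R_{\mathcal{I}}:\mathbb{R}^{\mathcal{V}}\to\mathbb{R}^{\mathcal{I}}$ is restriction to $\mathcal{I}$, and $R_{\mathcal{I}}^T$ is extension by zero. $\delta_e:\mathcal{E}\to\mathbb{R}$ is defined by $\delta_e(e')=1$ if $e'=e$ and $0$ otherwise. $\langle\cdot\rangle$ denotes expectation and $\kappa>0$ is a constant (the Boltzmann constant). Thermal-noise boundary currents: for a temperature $T:\mathcal{E}\to(0,\infty)$, let $J_{\text{noise}}$ be a random vector in $\mathbb{R}^{\mathcal{E}}$ with $\langle J_{\text{noise}}(e)\rangle=0$ and $\langle J_{\text{noise}}(e)J_{\text{noise}}(e')\rangle=\frac{\kappa}{\pi}\delta_{e,e'}T(e)\sigma(e)$ for all $e,e'\in\mathcal{E}$ (with $\delta_{e,e'}=1$ if $e=e'$, else $0$). Let $v:\mathcal{V}\to\mathbb{R}$ be the (random) solution of $[\nabla^T(\sigma\odot\nabla v)]_{\mathcal{I}}=(\nabla^TJ_{\text{noise}})_{\mathcal{I}}$,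 $v_{\mathcal{B}}=0$. The thermal-noise boundary currents at temperature $T$ are $g=(L_\sigma v)_{\mathcal{B}}$, a random vector in $\mathbb{R}^{\mathcal{B}}$; $g_0$ and $g_e$ denote $g$ for $T=T_0$ and $T=T_e$ respectively. *)

theory Defs
  imports "HOL-Probability.Probability"
begin

text \<open>
  A vector indexed by a finite set is a function of which only the values on that set matter;
  operators return functions that are \<^const>\<open>undefined\<close> outside the index set
  (\<^const>\<open>restrict\<close>), so that equality of results is equality of vectors. A matrix with
  rows in \<open>R\<close> and columns in \<open>C\<close> is likewise a curried function.
\<close>

text \<open>
  Edges are two-element sets of nodes; \<open>src\<close> and \<open>tgt\<close> are the fixed ordering of the endpoints.
\<close>

record 'v ograph =
  nodes :: "'v set"
  edges :: "'v set set"
  src :: "'v set \<Rightarrow> 'v"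
  tgt :: "'v set \<Rightarrow> 'v"

definition finite_loopless_graph :: "'v ograph \<Rightarrow> bool" where
  "finite_loopless_graph G \<longleftrightarrow>
     finite (nodes G) \<and>
     (\<forall>e\<in>edges G. e \<subseteq> nodes G \<and> card e = 2 \<and> e = {src G e, tgt G e})"

definition delta :: "'a \<Rightarrow> 'a \<Rightarrow> real" where
  "delta a b = (if b = a then 1 else 0)"

definition submatrix_on :: "'a set \<Rightarrow> 'b set \<Rightarrow> ('a \<Rightarrow> 'b \<Rightarrow> real) \<Rightarrow> 'a \<Rightarrow> 'b \<Rightarrow> real" where
  "submatrix_on R C A = (\<lambda>i\<in>R. \<lambda>j\<in>C. A i j)"

definition invertible_on :: "'a set \<Rightarrow> ('a \<Rightarrow> 'a \<Rightarrow> real) \<Rightarrow> bool" where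
  "invertible_on S A \<longleftrightarrow>
     (\<exists>N. \<forall>i\<in>S. \<forall>j\<in>S. (\<Sum>k\<in>S. A i k * N k j) = delta i j \<and>
                       (\<Sum>k\<in>S. N i k * A k j) = delta i j)"

definition quad_form :: "'a set \<Rightarrow> ('a \<Rightarrow> 'a \<Rightarrow> real) \<Rightarrow> ('a \<Rightarrow> real) \<Rightarrow> real" where
  "quad_form S A f = (\<Sum>i\<in>S. \<Sum>j\<in>S. f i * A i j * f j)"

definition ext_zero :: "'a set \<Rightarrow> 'a set \<Rightarrow> ('a \<Rightarrow> real) \<Rightarrow> 'a \<Rightarrow> real" where
  "ext_zero V S w = (\<lambda>i\<in>V. if i \<in> S then w i else 0)"

definition grad :: "'v ograph \<Rightarrow> ('v \<Rightarrow> real) \<Rightarrow> 'v set \<Rightarrow> real" where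
  "grad G u = (\<lambda>e\<in>edges G. u (src G e) - u (tgt G e))"

text \<open>
  The matrix of the gradient has entries \<^term>\<open>grad G (delta i) e\<close> (row \<open>e\<close>, column \<open>i\<close>).
\<close>

definition grad_transpose :: "'v ograph \<Rightarrow> ('v set \<Rightarrow> real) \<Rightarrow> 'v \<Rightarrow> real" where
  "grad_transpose G J = (\<lambda>i\<in>nodes G. \<Sum>e\<in>edges G. grad G (delta i) e * J e)"

definition laplacian :: "'v ograph \<Rightarrow> ('v set \<Rightarrow> real) \<Rightarrow> ('v \<Rightarrow> real) \<Rightarrow> 'v \<Rightarrow> real" where
  "laplacian G \<sigma> u = grad_transpose G (\<lambda>e\<in>edges G. \<sigma> e * grad G u e)"

definition laplacian_matrix :: "'v ograph \<Rightarrow> ('v set \<Rightarrow> real) \<Rightarrow> 'v \<Rightarrow> 'v \<Rightarrow> real" where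
  "laplacian_matrix G \<sigma> = (\<lambda>i\<in>nodes G. \<lambda>j\<in>nodes G. laplacian G \<sigma> (delta j) i)"

text \<open>
  \<^const>\<open>has_bochner_integral\<close> rather than the value of the integral, so that the moments exist.
\<close>

definition thermal_noise ::
  "'v ograph \<Rightarrow> ('v set \<Rightarrow> real) \<Rightarrow> real \<Rightarrow> ('v set \<Rightarrow> real) \<Rightarrow>
   'w measure \<Rightarrow> ('w \<Rightarrow> 'v set \<Rightarrow> real) \<Rightarrow> bool" where
  "thermal_noise G \<sigma> \<kappa> T M J \<longleftrightarrow>
     prob_space M \<and>
     J \<in> M \<rightarrow>\<^sub>M (\<Pi>\<^sub>M e\<in>edges G. borel) \<and>
     (\<forall>e\<in>edges G. has_bochner_integral M (\<lambda>\<omega>. J \<omega> e) 0) \<and>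
     (\<forall>e\<in>edges G. \<forall>e'\<in>edges G.
        has_bochner_integral M (\<lambda>\<omega>. J \<omega> e * J \<omega> e') (\<kappa> / pi * delta e e' * T e * \<sigma> e))"

definition thermal_noise_boundary_currents ::
  "'v ograph \<Rightarrow> 'v set \<Rightarrow> 'v set \<Rightarrow> ('v set \<Rightarrow> real) \<Rightarrow> real \<Rightarrow> ('v set \<Rightarrow> real) \<Rightarrow>
   'w measure \<Rightarrow> ('w \<Rightarrow> 'v \<Rightarrow> real) \<Rightarrow> bool" where
  "thermal_noise_boundary_currents G B I \<sigma> \<kappa> T M g \<longleftrightarrow>
     (\<exists>J v. thermal_noise G \<sigma> \<kappa> T M J \<and>
        (\<forall>\<omega>\<in>space M.
           (\<forall>i\<in>I. laplacian G \<sigma> (v \<omega>) i = grad_transpose G (J \<omega>) i) \<and>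
           (\<forall>i\<in>B. v \<omega> i = 0) \<and>
           g \<omega> = restrict (laplacian G \<sigma> (v \<omega>)) B))"

text \<open>
  The matrix of second moments, which is the covariance because the currents have mean zero.
\<close>

definition second_moment :: "'w measure \<Rightarrow> ('w \<Rightarrow> 'a \<Rightarrow> real) \<Rightarrow> 'a \<Rightarrow> 'a \<Rightarrow> real" where
  "second_moment M g i j = (\<integral>\<omega>. g \<omega> i * g \<omega> j \<partial>M)"

end

theory Submission
  imports Defs
begin

text \<open>
  The quadratic form \<open>f\<^sup>T \<langle>g g\<^sup>T\<rangle> f\<close> is the second moment of the
  scalar \<open>\<langle>f, g\<rangle>\<close>, the boundary currents tested against the data \<open>f\<close>.
  Green's identity expresses this scalar through the noise alone. Since \<open>u\<close> is harmonic in the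
  interior and \<open>v\<close> vanishes on the boundary, symmetry of the Laplacian gives
  \<open>\<langle>u, L v\<rangle> = \<langle>L u, v\<rangle> = 0\<close>, so the boundary part of
  \<open>\<langle>u, L v\<rangle>\<close> is minus its interior part. In the interior
  \<open>L v = \<nabla>\<^sup>T J\<close>, and moving \<open>\<nabla>\<^sup>T\<close> to the other side yields
  \<open>\<langle>f, g\<rangle> = - \<langle>\<nabla> w, J\<rangle>\<close>, where \<open>w\<close> is \<open>u\<close> with its boundary values
  replaced by zero (lemma \<open>harmonic_pairing_with_boundary_currents\<close>).
  The noise is uncorrelated across edges, hence
  \<open>f\<^sup>T \<langle>g g\<^sup>T\<rangle> f\<close> is \<open>\<kappa> / \<pi>\<close> times the sum over all edges of
  \<open>T \<sigma> |\<nabla> w|\<^sup>2\<close> (lemma \<open>quad_form_thermal_noise\<close>). This is linear in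
  the temperature, and raising \<open>T\<close> by \<open>\<delta>T\<close> on a single edge isolates that edge's summand.

  One analytic point remains: identifying \<open>f\<^sup>T \<langle>g g\<^sup>T\<rangle> f\<close> with a second moment
  requires every product \<open>g i * g j\<close> to be integrable, whereas \<open>v\<close> is given only pointwise as a
  solution of a linear system. Invertibility of the interior block provides, for each boundary node
  \<open>b\<close>, a harmonic function with boundary data \<open>\<delta>\<^sub>b\<close>
  (lemma \<open>dirichlet_problem_solvable\<close>). The same Green identity applied to it shows
  that \<open>g b\<close> is a fixed linear combination of the noise components, whose products are integrable.
\<close>

section \<open>The discrete Green identity\<close>

abbreviation (input) interior_part :: "'v ograph \<Rightarrow> 'v set \<Rightarrow> ('v \<Rightarrow> real) \<Rightarrow> 'v \<Rightarrow> real" where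
  "interior_part G I u \<equiv> ext_zero (nodes G) I (restrict u I)"

lemma sum_delta:
  assumes "finite S" "j \<in> S"
  shows "(\<Sum>i\<in>S. w i * delta i j) = w j" "(\<Sum>i\<in>S. w i * delta j i) = w j"
  using assms by (simp_all add: delta_def if_distrib sum.delta cong: if_cong)

lemma finite_edges:
  assumes "finite_loopless_graph G"
  shows "finite (edges G)"
  by (rule finite_subset[of _ "Pow (nodes G)"]) (use assms in \<open>auto simp: finite_loopless_graph_def\<close>)

lemma endpoints_in_nodes:
  assumes "finite_loopless_graph G" "e \<in> edges G"
  shows "src G e \<in> nodes G" "tgt G e \<in> nodes G"
  using assms unfolding finite_loopless_graph_def by blast+

lemma grad_transpose_adjoint:
  assumes G: "finite_loopless_graph G"
  shows "(\<Sum>i\<in>nodes G. w i * grad_transpose G J i) = (\<Sum>e\<in>edges G. grad G w e * J e)"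
proof -
  have fin: "finite (nodes G)" using G by (simp add: finite_loopless_graph_def)
  have grad_expand: "(\<Sum>i\<in>nodes G. w i * grad G (delta i) e) = grad G w e" if "e \<in> edges G" for e
    using that endpoints_in_nodes[OF G that]
    by (simp add: grad_def right_diff_distrib sum_subtractf sum_delta[OF fin])
  have "(\<Sum>i\<in>nodes G. w i * grad_transpose G J i)
      = (\<Sum>i\<in>nodes G. \<Sum>e\<in>edges G. w i * grad G (delta i) e * J e)"
    by (simp add: grad_transpose_def sum_distrib_left mult.assoc)
  also have "\<dots> = (\<Sum>e\<in>edges G. (\<Sum>i\<in>nodes G. w i * grad G (delta i) e) * J e)"
    by (subst sum.swap) (simp add: sum_distrib_right)
  also have "\<dots> = (\<Sum>e\<in>edges G. grad G w e * J e)"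
    by (simp add: grad_expand)
  finally show ?thesis .
qed

lemma laplacian_symmetric:
  assumes G: "finite_loopless_graph G"
  shows "(\<Sum>i\<in>nodes G. u i * laplacian G \<sigma> v i) = (\<Sum>i\<in>nodes G. v i * laplacian G \<sigma> u i)"
  unfolding laplacian_def grad_transpose_adjoint[OF G] by (rule sum.cong) simp_all

text \<open>
  By symmetry the boundary and the interior part of \<open>\<langle>u, L v\<rangle>\<close> cancel. The interior part involves
  \<open>v\<close> only through the source \<open>\<nabla>\<^sup>T J\<close>, so the tested boundary current depends on \<open>J\<close> alone.
\<close>

lemma harmonic_pairing_with_boundary_currents:
  assumes G: "finite_loopless_graph G"
    and part: "nodes G = B \<union> I" "B \<inter> I = {}"
    and u: "\<forall>i\<in>I. laplacian G \<sigma> u i = 0"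
    and v: "\<forall>i\<in>I. laplacian G \<sigma> v i = grad_transpose G J i" "\<forall>i\<in>B. v i = 0"
  shows "(\<Sum>i\<in>B. u i * laplacian G \<sigma> v i) = - (\<Sum>e\<in>edges G. grad G (interior_part G I u) e * J e)"
proof -
  have fin: "finite B" "finite I"
    using G part by (auto simp: finite_loopless_graph_def)
  have split: "sum h (nodes G) = sum h B + sum h I" for h :: "_ \<Rightarrow> real"
    unfolding part(1) by (rule sum.union_disjoint[OF fin part(2)])
  have "(\<Sum>i\<in>edges G. grad G (interior_part G I u) i * J i)
      = (\<Sum>i\<in>B. interior_part G I u i * grad_transpose G J i)
        + (\<Sum>i\<in>I. interior_part G I u i * grad_transpose G J i)"
    unfolding grad_transpose_adjoint[OF G, symmetric] split ..
  moreover have "(\<Sum>i\<in>B. interior_part G I u i * grad_transpose G J i) = 0"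
    using part by (intro sum.neutral) (auto simp: ext_zero_def)
  moreover have "(\<Sum>i\<in>I. interior_part G I u i * grad_transpose G J i) = (\<Sum>i\<in>I. u i * laplacian G \<sigma> v i)"
    using part v(1) by (intro sum.cong) (auto simp: ext_zero_def)
  moreover have "(\<Sum>i\<in>nodes G. u i * laplacian G \<sigma> v i) = 0"
  proof -
    have "(\<Sum>i\<in>nodes G. v i * laplacian G \<sigma> u i) = 0"
      using part(1) u v(2) by (intro sum.neutral) auto
    then show ?thesis using laplacian_symmetric[OF G, of u \<sigma> v] by simp
  qed
  ultimately show ?thesis using split[of "\<lambda>i. u i * laplacian G \<sigma> v i"] by linarith
qed

section \<open>Solvability of the Dirichlet problem\<close>

text \<open>
  Testing with \<open>\<delta>\<^sub>i\<close> turns both the value \<open>(L u)(i)\<close> and the matrix entries into pairings,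
  so that the expansion follows from symmetry without a separate linearity argument.
\<close>

lemma laplacian_matrix_apply:
  assumes G: "finite_loopless_graph G" and i: "i \<in> nodes G"
  shows "laplacian G \<sigma> u i = (\<Sum>j\<in>nodes G. laplacian_matrix G \<sigma> i j * u j)"
proof -
  have fin: "finite (nodes G)" using G by (simp add: finite_loopless_graph_def)
  have "laplacian G \<sigma> u i = (\<Sum>j\<in>nodes G. laplacian G \<sigma> u j * delta i j)"
    using i by (simp add: sum_delta[OF fin])
  also have "\<dots> = (\<Sum>j\<in>nodes G. u j * laplacian G \<sigma> (delta i) j)"
    using laplacian_symmetric[OF G, of "delta i" \<sigma> u] by (simp add: mult.commute)
  also have "\<dots> = (\<Sum>j\<in>nodes G. laplacian_matrix G \<sigma> i j * u j)"
  proof (rule sum.cong[OF refl])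
    fix j assume j: "j \<in> nodes G"
    have "laplacian G \<sigma> (delta i) j = (\<Sum>k\<in>nodes G. laplacian G \<sigma> (delta i) k * delta j k)"
      using j by (simp add: sum_delta[OF fin])
    also have "\<dots> = (\<Sum>k\<in>nodes G. laplacian G \<sigma> (delta j) k * delta i k)"
      using laplacian_symmetric[OF G, of "delta j" \<sigma> "delta i"] by (simp add: mult.commute)
    also have "\<dots> = laplacian_matrix G \<sigma> i j"
      using i j by (simp add: sum_delta[OF fin] laplacian_matrix_def)
    finally show "u j * laplacian G \<sigma> (delta i) j = laplacian_matrix G \<sigma> i j * u j" by simp
  qed
  finally show ?thesis .
qed

lemma dirichlet_problem_solvable:
  assumes G: "finite_loopless_graph G"
    and part: "nodes G = B \<union> I" "B \<inter> I = {}"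
    and inv: "invertible_on I (submatrix_on I I (laplacian_matrix G \<sigma>))"
  shows "\<exists>u. (\<forall>i\<in>I. laplacian G \<sigma> u i = 0) \<and> (\<forall>i\<in>B. u i = f i)"
proof -
  let ?A = "laplacian_matrix G \<sigma>"
  have fin: "finite B" "finite I"
    using G part by (auto simp: finite_loopless_graph_def)
  obtain N where N: "\<forall>i\<in>I. \<forall>j\<in>I. (\<Sum>k\<in>I. ?A i k * N k j) = delta i j"
    using inv by (auto simp: invertible_on_def submatrix_on_def)
  define h where "h j = (\<Sum>b\<in>B. ?A j b * f b)" for j
  \<comment> \<open>The boundary values act on the interior as the source \<open>-h\<close>.\<close>
  define u where "u k = (if k \<in> B then f k else - (\<Sum>j\<in>I. N k j * h j))" for k
  have "laplacian G \<sigma> u i = 0" if i: "i \<in> I" for i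
  proof -
    have "laplacian G \<sigma> u i = (\<Sum>k\<in>B. ?A i k * u k) + (\<Sum>k\<in>I. ?A i k * u k)"
      using i part laplacian_matrix_apply[OF G, of i \<sigma> u] sum.union_disjoint[OF fin part(2)] by simp
    also have "(\<Sum>k\<in>B. ?A i k * u k) = h i"
      by (simp add: u_def h_def)
    also have "(\<Sum>k\<in>I. ?A i k * u k) = (\<Sum>k\<in>I. - (\<Sum>j\<in>I. ?A i k * N k j * h j))"
      using part(2) by (intro sum.cong) (auto simp: u_def sum_distrib_left mult.assoc)
    also have "\<dots> = - (\<Sum>j\<in>I. (\<Sum>k\<in>I. ?A i k * N k j) * h j)"
      unfolding sum_negf by (subst sum.swap) (simp add: sum_distrib_right)
    also have "\<dots> = - (\<Sum>j\<in>I. h j * delta i j)"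
      using N i by (simp add: mult.commute)
    also have "\<dots> = - h i"
      using sum_delta(2)[OF fin(2) i] by simp
    finally show ?thesis by simp
  qed
  then show ?thesis by (intro exI[of _ u]) (simp add: u_def)
qed

section \<open>Second moments of the boundary currents\<close>

lemma thermal_noise_linear_functionals:
  assumes G: "finite_loopless_graph G" and J: "thermal_noise G \<sigma> \<kappa> T M J"
  shows "has_bochner_integral M
    (\<lambda>\<omega>. (\<Sum>e\<in>edges G. a e * J \<omega> e) * (\<Sum>e\<in>edges G. b e * J \<omega> e))
    (\<kappa> / pi * (\<Sum>e\<in>edges G. T e * \<sigma> e * (a e * b e)))"
proof -
  let ?E = "edges G"
  have fin: "finite ?E" by (rule finite_edges[OF G])
  have "has_bochner_integral M (\<lambda>\<omega>. \<Sum>e\<in>?E. \<Sum>e'\<in>?E. (a e * b e') * (J \<omega> e * J \<omega> e'))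
     (\<Sum>e\<in>?E. \<Sum>e'\<in>?E. (a e * b e') * (\<kappa> / pi * delta e e' * T e * \<sigma> e))"
    using J unfolding thermal_noise_def
    by (intro has_bochner_integral_sum has_bochner_integral_mult_right) auto
  moreover have "(\<Sum>e\<in>?E. a e * J \<omega> e) * (\<Sum>e\<in>?E. b e * J \<omega> e)
      = (\<Sum>e\<in>?E. \<Sum>e'\<in>?E. (a e * b e') * (J \<omega> e * J \<omega> e'))" for \<omega>
    unfolding sum_product by (intro sum.cong) (simp_all add: mult_ac)
  moreover have "(\<Sum>e\<in>?E. \<Sum>e'\<in>?E. (a e * b e') * (\<kappa> / pi * delta e e' * T e * \<sigma> e))
      = \<kappa> / pi * (\<Sum>e\<in>?E. T e * \<sigma> e * (a e * b e))"
  proof -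
    have "(\<Sum>e'\<in>?E. (a e * b e') * (\<kappa> / pi * delta e e' * T e * \<sigma> e))
        = \<kappa> / pi * (T e * \<sigma> e * (a e * b e))" if e: "e \<in> ?E" for e
    proof -
      have "(\<Sum>e'\<in>?E. (a e * b e') * (\<kappa> / pi * delta e e' * T e * \<sigma> e))
          = (\<Sum>e'\<in>?E. (a e * b e' * (\<kappa> / pi) * T e * \<sigma> e) * delta e e')"
        by (simp add: mult_ac)
      also have "\<dots> = a e * b e * (\<kappa> / pi) * T e * \<sigma> e"
        by (rule sum_delta(2)[OF fin e])
      finally show ?thesis by (simp add: mult_ac)
    qed
    then show ?thesis by (simp add: sum_distrib_left)
  qed
  ultimately show ?thesis by simp
qed

text \<open>
  Green's identity enters twice: with the solutions for the boundary data \<open>\<delta>\<^sub>b\<close> it makes the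
  products of currents integrable, so that the quadratic form may be taken inside the expectation,
  and with \<open>u\<close> itself it evaluates the resulting scalar.
\<close>

lemma quad_form_thermal_noise:
  assumes G: "finite_loopless_graph G"
    and part: "nodes G = B \<union> I" "B \<inter> I = {}"
    and inv: "invertible_on I (submatrix_on I I (laplacian_matrix G \<sigma>))"
    and u: "\<forall>i\<in>I. laplacian G \<sigma> u i = 0" "\<forall>i\<in>B. u i = f i"
    and g: "thermal_noise_boundary_currents G B I \<sigma> \<kappa> T M g"
  shows "quad_form B (second_moment M g) f
    = \<kappa> / pi * (\<Sum>e\<in>edges G. T e * \<sigma> e * (grad G (interior_part G I u) e)\<^sup>2)"
proof -
  have fin: "finite B"
    using G part by (auto simp: finite_loopless_graph_def)
  obtain J v where J: "thermal_noise G \<sigma> \<kappa> T M J"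
    and v: "\<And>\<omega>. \<omega> \<in> space M \<Longrightarrow> \<forall>i\<in>I. laplacian G \<sigma> (v \<omega>) i = grad_transpose G (J \<omega>) i"
      "\<And>\<omega>. \<omega> \<in> space M \<Longrightarrow> \<forall>i\<in>B. v \<omega> i = 0"
    and g_eq: "\<And>\<omega>. \<omega> \<in> space M \<Longrightarrow> g \<omega> = restrict (laplacian G \<sigma> (v \<omega>)) B"
    using g unfolding thermal_noise_boundary_currents_def by blast
  have pairing: "(\<Sum>i\<in>B. w i * g \<omega> i) = - (\<Sum>e\<in>edges G. grad G (interior_part G I w) e * J \<omega> e)"
    if "\<forall>i\<in>I. laplacian G \<sigma> w i = 0" "\<omega> \<in> space M" for w \<omega>
    using harmonic_pairing_with_boundary_currents[OF G part that(1) v[OF that(2)]] that(2)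
    by (simp add: g_eq)
  have "\<exists>a. \<forall>\<omega>\<in>space M. g \<omega> b = - (\<Sum>e\<in>edges G. a e * J \<omega> e)" if b: "b \<in> B" for b
  proof -
    obtain w where w: "\<forall>i\<in>I. laplacian G \<sigma> w i = 0" "\<forall>i\<in>B. w i = delta b i"
      using dirichlet_problem_solvable[OF G part inv, of "delta b"] by blast
    have "g \<omega> b = - (\<Sum>e\<in>edges G. grad G (interior_part G I w) e * J \<omega> e)" if "\<omega> \<in> space M" for \<omega>
    proof -
      have "g \<omega> b = (\<Sum>i\<in>B. w i * g \<omega> i)"
        using w(2) sum_delta(2)[OF fin b, of "g \<omega>"] by (simp add: mult.commute)
      then show ?thesis using pairing[OF w(1) that] by simp
    qed
    then show ?thesis by blast
  qed
  then obtain a where a: "\<And>b \<omega>. b \<in> B \<Longrightarrow> \<omega> \<in> space M \<Longrightarrow> g \<omega> b = - (\<Sum>e\<in>edges G. a b e * J \<omega> e)"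
    by metis
  have "integrable M (\<lambda>\<omega>. g \<omega> i * g \<omega> j)" if ij: "i \<in> B" "j \<in> B" for i j
  proof -
    have "integrable M (\<lambda>\<omega>. (\<Sum>e\<in>edges G. a i e * J \<omega> e) * (\<Sum>e\<in>edges G. a j e * J \<omega> e))"
      using thermal_noise_linear_functionals[OF G J] by (rule integrable.intros)
    then show ?thesis
      by (rule Bochner_Integration.integrable_cong[OF refl, THEN iffD1, rotated]) (simp add: a ij)
  qed
  then have "quad_form B (second_moment M g) f = (\<integral>\<omega>. (\<Sum>i\<in>B. \<Sum>j\<in>B. f i * f j * (g \<omega> i * g \<omega> j)) \<partial>M)"
    by (simp add: quad_form_def second_moment_def mult_ac)
  also have "\<dots> = (\<integral>\<omega>. (\<Sum>e\<in>edges G. grad G (interior_part G I u) e * J \<omega> e)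
      * (\<Sum>e\<in>edges G. grad G (interior_part G I u) e * J \<omega> e) \<partial>M)"
  proof (rule Bochner_Integration.integral_cong[OF refl])
    fix \<omega> assume \<omega>: "\<omega> \<in> space M"
    have "(\<Sum>i\<in>B. \<Sum>j\<in>B. f i * f j * (g \<omega> i * g \<omega> j)) = (\<Sum>i\<in>B. u i * g \<omega> i) * (\<Sum>i\<in>B. u i * g \<omega> i)"
      unfolding sum_product using u(2) by (intro sum.cong) (simp_all add: mult_ac)
    then show "(\<Sum>i\<in>B. \<Sum>j\<in>B. f i * f j * (g \<omega> i * g \<omega> j))
      = (\<Sum>e\<in>edges G. grad G (interior_part G I u) e * J \<omega> e)
        * (\<Sum>e\<in>edges G. grad G (interior_part G I u) e * J \<omega> e)"
      by (simp add: pairing[OF u(1) \<omega>])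
  qed
  also have "\<dots> = \<kappa> / pi * (\<Sum>e\<in>edges G. T e * \<sigma> e * (grad G (interior_part G I u) e)\<^sup>2)"
    unfolding power2_eq_square
    by (rule has_bochner_integral_integral_eq[OF thermal_noise_linear_functionals[OF G J]])
  finally show ?thesis .
qed

section \<open>Heating a single edge\<close>

theorem theorem1:
  fixes G :: "'v ograph"
    and B I :: "'v set"
    and \<sigma> :: "'v set \<Rightarrow> real"
    and f u :: "'v \<Rightarrow> real"
    and \<kappa> T0 \<delta>T :: real
    and M0 :: "'w0 measure" and g0 :: "'w0 \<Rightarrow> 'v \<Rightarrow> real"
    and M :: "'v set \<Rightarrow> 'w measure" and g :: "'v set \<Rightarrow> 'w \<Rightarrow> 'v \<Rightarrow> real"
  assumes "finite_loopless_graph G"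
    and "nodes G = B \<union> I" and "B \<inter> I = {}"
    and "\<forall>e\<in>edges G. \<sigma> e > 0"
    and "invertible_on I (submatrix_on I I (laplacian_matrix G \<sigma>))"
    and "\<forall>i\<in>I. laplacian G \<sigma> u i = 0" and "\<forall>i\<in>B. u i = f i"
    and "\<kappa> > 0" and "T0 > 0" and "T0 + \<delta>T > 0"
    and "thermal_noise_boundary_currents G B I \<sigma> \<kappa> (\<lambda>e'. T0) M0 g0"
    and "\<forall>e\<in>edges G.
           thermal_noise_boundary_currents G B I \<sigma> \<kappa> (\<lambda>e'. T0 + \<delta>T * delta e e') (M e) (g e)"
  shows "(\<lambda>e\<in>edges G.
            quad_form B (\<lambda>i j. second_moment (M e) (g e) i j - second_moment M0 g0 i j) f)
       = (\<lambda>e\<in>edges G.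
            \<kappa> / pi * \<delta>T * (\<sigma> e * \<bar>grad G (ext_zero (nodes G) I (restrict u I)) e\<bar>\<^sup>2))"
proof (rule restrict_ext)
  fix e assume e: "e \<in> edges G"
  let ?w = "grad G (interior_part G I u)"
  have "quad_form B (\<lambda>i j. second_moment (M e) (g e) i j - second_moment M0 g0 i j) f
      = quad_form B (second_moment (M e) (g e)) f - quad_form B (second_moment M0 g0) f"
    by (simp add: quad_form_def algebra_simps sum_subtractf)
  also have "\<dots> = \<kappa> / pi * (\<Sum>e'\<in>edges G. (T0 + \<delta>T * delta e e') * \<sigma> e' * (?w e')\<^sup>2)
      - \<kappa> / pi * (\<Sum>e'\<in>edges G. T0 * \<sigma> e' * (?w e')\<^sup>2)"
    using quad_form_thermal_noise[OF assms(1-3,5-7) assms(12)[rule_format, OF e]]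
      quad_form_thermal_noise[OF assms(1-3,5-7,11)]
    by simp
  also have "\<dots> = \<kappa> / pi * (\<Sum>e'\<in>edges G. (\<delta>T * \<sigma> e' * (?w e')\<^sup>2) * delta e e')"
    by (simp add: algebra_simps sum.distrib add_divide_distrib)
  also have "\<dots> = \<kappa> / pi * \<delta>T * (\<sigma> e * \<bar>?w e\<bar>\<^sup>2)"
    by (simp add: sum_delta(2)[OF finite_edges[OF assms(1)] e])
  finally show "quad_form B (\<lambda>i j. second_moment (M e) (g e) i j - second_moment M0 g0 i j) f
      = \<kappa> / pi * \<delta>T * (\<sigma> e * \<bar>?w e\<bar>\<^sup>2)" .
qed

end
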